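(* Let $\mathcal{A}$ be a generic arrangement of $r\ge n$ hyperplanes in $K^n$ ($n\geq 2$), and let $m\ge r-n+1$ be an integer. Let $\tilde r:=n+m-1$, and let $\widetilde{\mathcal{A}}=\mathcal{A}\cup\{H_{r+1},\ldots,H_{\tilde r}\}$ be obtained from $\mathcal{A}$ by adding $\tilde r-r$ hyperplanes so that $\widetilde{\mathcal{A}}$ (consisting of $\tilde r$ hyperplanes) is still generic. For $\mathcal{H}\in\widetilde{\mathcal{A}}^{(n-1)}$ put $P'_{\mathcal{H}}:=\prod_{H\in\mathcal{A},\,H\notin\mathcal{H}}p_H\in S$. Then the $S$-module $D^{(m)}(\mathcal{A})$ is free with basis $\{P'_{\mathcal{H}}\delta_{\mathcal{H}}^m \mid \mathcal{H}\in\widetilde{\mathcal{A}}^{(n-1)}\}$.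
   Context: $K$ is a field of characteristic zero and $S=K[x_1,\ldots,x_n]$. All hyperplanes are linear (pass through the origin of $K^n$); an arrangement is a finite set of distinct hyperplanes; it is generic if every $n$ of its hyperplanes intersect only at the origin. For each hyperplane $H$, $p_H\in S$ is a fixed linear form defining $H$, and $Q=\prod_{H\in\mathcal{A}}p_H$. $D(S)=S\langle\partial_1,\ldots,\partial_n\rangle$ is the $n$th Weyl algebra, acting on $S$ by $*$; $D^{(m)}(S)=\bigoplus_{|\alpha|=m}S\partial^\alpha$ is the $S$-module of differential operators homogeneous of order $m$. $D(\mathcal{A})=\{\theta\in D(S)\mid \theta*(QS)\subseteq QS\}$ and $D^{(m)}(\mathcal{A})=D(\mathcal{A})\cap D^{(m)}(S)$. For a finite set $\mathcal{S}$, $\mathcal{S}^{(k)}$ is the set of its subsets of cardinality $k$. For an $(n-1)$-subset $\mathcal{H}$ of a generic arrangement, $\delta_{\mathcal{H}}$ is a fixed nonzero element of the one-dimensional space $\{\delta\in\sum_{i=1}^nK\partial_i\mid \delta*p_H=0 \text{ for all } H\in\mathcal{H}\}$, and $\delta_{\mathcal{H}}^m$ is its $m$th power in $D(S)$. *)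

theory Defs
  imports
    "HOL-Analysis.Analysis"
    "HOL-Library.Poly_Mapping"
    "HOL-Library.Function_Algebras"
    "HOL-Library.Ramsey"
begin

section \<open>The polynomial ring\<close>

text \<open>The ring $S = K[x_1,...,x_n]$, the variables being indexed by the type \<open>'n\<close>: finitely supported maps from exponent vectors to
  coefficients, with the convolution product.\<close>

type_synonym ('n, 'a) mpoly = "('n \<Rightarrow>\<^sub>0 nat) \<Rightarrow>\<^sub>0 'a"

definition Const :: "'a \<Rightarrow> ('n, 'a::zero) mpoly"
  where "Const c = Poly_Mapping.single 0 c"

definition Var :: "'n \<Rightarrow> ('n, 'a::zero_neq_one) mpoly"
  where "Var i = Poly_Mapping.single (Poly_Mapping.single i 1) 1"

definition eval_mpoly :: "'a^'n \<Rightarrow> ('n::finite, 'a::comm_semiring_1) mpoly \<Rightarrow> 'a"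
  where "eval_mpoly v f =
    (\<Sum>\<alpha>\<in>Poly_Mapping.keys f. Poly_Mapping.lookup f \<alpha> * (\<Prod>i\<in>UNIV. (v $ i) ^ Poly_Mapping.lookup \<alpha> i))"

definition linear_forms :: "('n::finite, 'a::comm_semiring_1) mpoly set"
  where "linear_forms = range (\<lambda>a :: 'a^'n. \<Sum>i\<in>UNIV. Const (a $ i) * Var i)"


section \<open>Differential operators on the polynomial ring\<close>

text \<open>In characteristic zero the Weyl algebra acts faithfully on $S$, so its elements are
  represented by the additive maps $S \to S$ which they induce.  The product of the Weyl algebra
  is then composition; powers of operators are therefore written with \<open>^^\<close>, whereas \<open>^\<close> and \<open>*\<close>
  on functions would be pointwise.\<close>

type_synonym ('n, 'a) op = "('n, 'a) mpoly \<Rightarrow> ('n, 'a) mpoly"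

text \<open>The truncated subtraction of exponents is harmless: where it truncates, the
  coefficient vanishes.\<close>

definition partial :: "'n \<Rightarrow> ('n, 'a::comm_ring_1) op"
  where "partial i f = (\<Sum>\<alpha>\<in>Poly_Mapping.keys f.
    Poly_Mapping.single (\<alpha> - Poly_Mapping.single i 1)
      (of_nat (Poly_Mapping.lookup \<alpha> i) * Poly_Mapping.lookup f \<alpha>))"

lemma lookup_partial:
  "Poly_Mapping.lookup (partial i f) \<beta> =
     of_nat (Suc (Poly_Mapping.lookup \<beta> i)) * Poly_Mapping.lookup f (\<beta> + Poly_Mapping.single i 1)"
proof -
  let ?e = "Poly_Mapping.single i (1::nat)"
  let ?c = "\<lambda>\<alpha>. of_nat (Poly_Mapping.lookup \<alpha> i) * Poly_Mapping.lookup f \<alpha>"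
  have *: "(?c \<alpha> when \<alpha> - ?e = \<beta>) = (?c \<alpha> when \<alpha> = \<beta> + ?e)" for \<alpha>
  proof (cases "Poly_Mapping.lookup \<alpha> i = 0")
    case True
    then have "\<alpha> \<noteq> \<beta> + ?e"
      by (auto simp: lookup_add)
    with True show ?thesis by simp
  next
    case False
    have "\<alpha> = (\<alpha> - ?e) + ?e"
      using False by (intro poly_mapping_eqI)
        (auto simp: lookup_add lookup_minus lookup_single when_def)
    then have "\<alpha> - ?e = \<beta> \<longleftrightarrow> \<alpha> = \<beta> + ?e"
      by (metis add_diff_cancel_right')
    then show ?thesis by simp
  qed
  have "Poly_Mapping.lookup (partial i f) \<beta> = (\<Sum>\<alpha>\<in>Poly_Mapping.keys f. ?c \<alpha> when \<alpha> - ?e = \<beta>)"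
    by (simp add: partial_def lookup_sum lookup_single)
  also have "\<dots> = (\<Sum>\<alpha>\<in>Poly_Mapping.keys f. if \<alpha> = \<beta> + ?e then ?c \<alpha> else 0)"
    unfolding * by (simp add: when_def)
  also have "\<dots> = ?c (\<beta> + ?e)"
    by (auto simp: sum.delta' in_keys_iff)
  finally show ?thesis
    by (simp add: lookup_add)
qed

lemma partial_commute: "partial i (partial j f) = partial j (partial i f)"
proof (cases "i = j")
  case False
  then show ?thesis
    by (intro poly_mapping_eqI)
      (simp add: lookup_partial lookup_add lookup_single when_def algebra_simps)
qed simp

definition partial_monom :: "('n \<Rightarrow>\<^sub>0 nat) \<Rightarrow> ('n::finite, 'a::comm_ring_1) op"  (\<open>\<partial>\<^sup>_\<close> [1000] 1000)
  where "\<partial>\<^sup>\<alpha> = Finite_Set.fold (\<lambda>i \<theta>. (partial i ^^ Poly_Mapping.lookup \<alpha> i) \<circ> \<theta>) id UNIV"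

text \<open>The order of the factors in \<open>\<partial>\<^sup>\<alpha>\<close> is immaterial, so the fold is meaningful.\<close>

lemma comp_fun_commute_partial:
  "comp_fun_commute (\<lambda>i (\<theta> :: ('n, 'a::comm_ring_1) op). (partial i ^^ k i) \<circ> \<theta>)"
proof
  fix i j :: 'n
  have 1: "partial i ((partial j ^^ l) f) = (partial j ^^ l) (partial i f)"
    for l and f :: "('n, 'a) mpoly"
    by (induction l) (auto simp: partial_commute[of i j])
  have "(partial i ^^ l') ((partial j ^^ l) f) = (partial j ^^ l) ((partial i ^^ l') f)"
    for l l' and f :: "('n, 'a) mpoly"
    by (induction l') (auto simp: 1)
  then show "((\<circ>) (partial j ^^ k j)) \<circ> ((\<circ>) (partial i ^^ k i)) =
      ((\<circ>) (partial i ^^ k i)) \<circ> ((\<circ>) (partial j ^^ k j) :: ('n, 'a) op \<Rightarrow> ('n, 'a) op)"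
    by (auto simp: fun_eq_iff)
qed

inductive_set weyl_algebra :: "('n, 'a::comm_ring_1) op set" where
  mult: "(\<lambda>g. f * g) \<in> weyl_algebra"
| partial: "partial i \<in> weyl_algebra"
| add: "\<theta> \<in> weyl_algebra \<Longrightarrow> \<eta> \<in> weyl_algebra \<Longrightarrow> \<theta> + \<eta> \<in> weyl_algebra"
| comp: "\<theta> \<in> weyl_algebra \<Longrightarrow> \<eta> \<in> weyl_algebra \<Longrightarrow> \<theta> \<circ> \<eta> \<in> weyl_algebra"

definition op_scale :: "('n, 'a::comm_ring_1) mpoly \<Rightarrow> ('n, 'a) op \<Rightarrow> ('n, 'a) op"
    (infixr \<open>\<cdot>\<^sub>S\<close> 75)
  where "f \<cdot>\<^sub>S \<theta> = (\<lambda>g. f * \<theta> g)"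

interpretation diffop: module "op_scale :: ('n, 'a::comm_ring_1) mpoly \<Rightarrow> ('n, 'a) op \<Rightarrow> _"
  by unfold_locales (auto simp: op_scale_def fun_eq_iff algebra_simps)

definition ops_of_order :: "nat \<Rightarrow> ('n::finite, 'a::comm_ring_1) op set"
  where "ops_of_order m =
    diffop.span {\<partial>\<^sup>\<alpha> | \<alpha>. (\<Sum>i\<in>UNIV. Poly_Mapping.lookup \<alpha> i) = m}"

definition free_with_basis :: "('n, 'a::comm_ring_1) op set \<Rightarrow> ('n, 'a) op set \<Rightarrow> bool"
  where "free_with_basis M B \<longleftrightarrow>
    diffop.subspace M \<and> B \<subseteq> M \<and> diffop.independent B \<and> diffop.span B = M"

definition const_derivations :: "('n::finite, 'a::comm_ring_1) op set"
  where "const_derivations = range (\<lambda>a :: 'a^'n. \<Sum>i\<in>UNIV. Const (a $ i) \<cdot>\<^sub>S partial i)"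


section \<open>Hyperplane arrangements\<close>

definition linear_hyperplane :: "('a::field^'n) set \<Rightarrow> bool"
  where "linear_hyperplane H \<longleftrightarrow> vec.subspace H \<and> vec.dim H = CARD('n) - 1"

definition arrangement :: "('a::field^'n) set set \<Rightarrow> bool"
  where "arrangement \<A> \<longleftrightarrow> finite \<A> \<and> (\<forall>H\<in>\<A>. linear_hyperplane H)"

definition generic_arrangement :: "('a::field^'n) set set \<Rightarrow> bool"
  where "generic_arrangement \<A> \<longleftrightarrow>
    arrangement \<A> \<and> (\<forall>\<B>\<in>[\<A>]\<^bsup>CARD('n)\<^esup>. \<Inter>\<B> = {0})"

definition defining_form :: "('a::field^'n) set \<Rightarrow> ('n::finite, 'a) mpoly \<Rightarrow> bool"
  where "defining_form H p \<longleftrightarrow> p \<in> linear_forms \<and> H = {v. eval_mpoly v p = 0}"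

text \<open>In the following two definitions \<open>p\<close> assigns to each hyperplane its chosen defining form.\<close>

definition arrangement_ops ::
    "(('a::field^'n) set \<Rightarrow> ('n::finite, 'a) mpoly) \<Rightarrow> ('a^'n) set set \<Rightarrow> ('n, 'a) op set"
  where "arrangement_ops p \<A> =
    (let Q = \<Prod>H\<in>\<A>. p H in {\<theta> \<in> weyl_algebra. \<theta> ` {Q * f | f. True} \<subseteq> {Q * f | f. True}})"

definition arrangement_ops_of_order ::
    "(('a::field^'n) set \<Rightarrow> ('n::finite, 'a) mpoly) \<Rightarrow> nat \<Rightarrow> ('a^'n) set set \<Rightarrow> ('n, 'a) op set"
  where "arrangement_ops_of_order p m \<A> = arrangement_ops p \<A> \<inter> ops_of_order m"

definition annihilating_derivations ::
    "(('a::field^'n) set \<Rightarrow> ('n::finite, 'a) mpoly) \<Rightarrow> ('a^'n) set set \<Rightarrow> ('n, 'a) op set"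
  where "annihilating_derivations p \<H> = {\<delta> \<in> const_derivations. \<forall>H\<in>\<H>. \<delta> (p H) = 0}"

end

theory Submission
  imports Defs "HOL-Library.Multiset"
begin

text \<open>
  Let $A'$ be the large arrangement, of $n + m - 1$ hyperplanes, and let $G$, $G'$ range over its
  $(n-1)$-subsets.  The polynomial $\delta_G * p_H$ is zero for $H \in G$ and, by genericity, a nonzero
  constant for the other $H \in A'$.  Everything follows from this.

  \<^emph>\<open>The powers $\delta_G^m$ form a basis of the constant-coefficient operators of order $m$.\<close>
  The product $q_G$ of the $p_H$ with $H \in A' \setminus G$ consists of $m$ linear forms, so
  $\delta_{G'}^m * q_G$ is $m!$ times the product of the constants $\delta_{G'} * p_H$
  (\<open>D_funpow_prod_linear\<close>).  If $G' \neq G$, one of the factors belongs to $G'$ and the product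
  vanishes; if $G' = G$, it is a unit (\<open>pairing\<close>).  Hence the $\delta_G^m$ are independent, and
  since there are as many of them as monomials of degree $m$ in $n$ variables, they span
  (\<open>ops_of_order_eq\<close>).  So every operator of order $m$ is $\theta = \sum_G f_G \delta_G^m$ with
  unique $f_G \in S$.

  \<^emph>\<open>Such a $\theta$ preserves $QS$ if and only if $P'_G$ divides $f_G$ for all $G$.\<close>  The
  forms dividing $Q$ split into those killed by $\delta_G$ and those occurring in $P'_G$, which gives
  one direction.  Conversely, the commutator of $\theta$ with multiplication by $p_H$ preserves $QS$
  as well, and it replaces $\delta_G^m$ by $m (\delta_G * p_H) \delta_G^{m-1}$
  (\<open>contract_symbol\<close>).  Fix $G$ and $H \in A \setminus G$ and take commutators with all forms of
  $A'$ outside $G \cup \{H\}$.  This leaves a derivation preserving $QS$ whose only contributions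
  come from the $G' \subseteq G \cup \{H\}$.  All of these except $G$ contain $H$ and
  hence map $Q$ into $p_H S$, so that $p_H$ must divide $f_G$ (\<open>preserves_imp_dvd\<close>).

  The divisibility arguments need that $p_H$ is not a zero divisor modulo a different $p_{H'}$, and
  modulo zero.  Both are instances of a statement about locally nilpotent derivations
  (\<open>dvd_mult_cancel_linear\<close>).
\<close>

section \<open>Derivations of commutative rings\<close>

locale derivation =
  fixes D :: "'r::comm_ring_1 \<Rightarrow> 'r"
  assumes D_add: "D (f + g) = D f + D g"
    and D_mult: "D (f * g) = D f * g + f * D g"
begin

lemma D_0 [simp]: "D 0 = 0"
  using D_add[of 0 0] by simp

lemma D_1 [simp]: "D 1 = 0"
  using D_mult[of 1 1] by simp

lemma D_of_nat [simp]: "D (of_nat k) = 0"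
  by (induction k) (simp_all add: D_add)

lemma D_power_mult: "D (q ^ k * f) = of_nat k * D q * q ^ (k - 1) * f + q ^ k * D f"
proof -
  have "D (q ^ k) = of_nat k * D q * q ^ (k - 1)"
  proof (induction k)
    case (Suc k)
    then show ?case by (cases k) (simp_all add: D_mult algebra_simps)
  qed simp
  then show ?thesis by (simp add: D_mult)
qed

lemma dvd_D: "d dvd D f" if "D d = 0" "d dvd f"
  using that by (auto simp: D_mult dvd_def)

lemma D_const_prod: "D (\<Prod>i\<in>B. c i) = 0" if "\<And>i. i \<in> B \<Longrightarrow> D (c i) = 0"
  using that by (induction B rule: infinite_finite_induct) (simp_all add: D_mult)

lemma D_funpow_0 [simp]: "(D ^^ k) 0 = 0"
  by (induction k) simp_all

lemma D_funpow_const_mult: "(D ^^ k) (c * f) = c * (D ^^ k) f" if "D c = 0"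
  using that by (induction k) (simp_all add: D_mult)

text \<open>The commutator of $D^{k+1}$ with multiplication by a \<open>linear\<close> element $g$, that is, one whose
  derivative is a constant of the derivation.\<close>

lemma D_funpow_mult_linear:
  assumes "D (D g) = 0"
  shows "(D ^^ Suc k) (g * f) = g * (D ^^ Suc k) f + of_nat (Suc k) * D g * (D ^^ k) f"
proof (induction k)
  case 0
  show ?case by (simp add: D_mult algebra_simps)
next
  case (Suc k)
  have "D (of_nat (Suc k) * D g) = 0"
    using assms by (simp only: D_mult D_of_nat) simp
  then have "D (of_nat (Suc k) * D g * (D ^^ k) f) = of_nat (Suc k) * D g * (D ^^ Suc k) f"
    by (simp only: D_mult) simp
  moreover have "(D ^^ Suc (Suc k)) (g * f) = D ((D ^^ Suc k) (g * f))"
    by simp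
  ultimately have "(D ^^ Suc (Suc k)) (g * f)
      = D g * (D ^^ Suc k) f + g * (D ^^ Suc (Suc k)) f + of_nat (Suc k) * D g * (D ^^ Suc k) f"
    by (simp only: Suc.IH D_add D_mult) simp
  then show ?case
    by (simp add: algebra_simps)
qed

text \<open>Each factor can absorb one derivative only, and there are as many factors as derivatives, so
  only the $|B|!$ ways of matching them contribute.\<close>

lemma D_funpow_prod_linear:
  assumes "finite B" and "\<And>i. i \<in> B \<Longrightarrow> D (D (q i)) = 0"
  shows "(D ^^ card B) (\<Prod>i\<in>B. q i) = of_nat (fact (card B)) * (\<Prod>i\<in>B. D (q i))"
  using assms
proof (induction B)
  case (insert i B)
  then have IH: "(D ^^ card B) (\<Prod>i\<in>B. q i) = of_nat (fact (card B)) * (\<Prod>i\<in>B. D (q i))"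
    by simp
  have "D (\<Prod>i\<in>B. D (q i)) = 0"
    using insert.prems by (intro D_const_prod) simp
  then have "(D ^^ Suc (card B)) (\<Prod>i\<in>B. q i) = 0"
    by (simp only: funpow.simps comp_def IH D_mult D_of_nat) simp
  then have "(D ^^ Suc (card B)) (q i * (\<Prod>i\<in>B. q i))
      = of_nat (Suc (card B)) * D (q i) * (of_nat (fact (card B)) * (\<Prod>i\<in>B. D (q i)))"
    using insert.prems[of i] by (simp only: D_funpow_mult_linear[of "q i"] IH insertI1) simp
  then show ?case
    using insert.hyps by (simp add: algebra_simps)
qed simp

text \<open>If $d$ is a constant of a locally nilpotent derivation, then its multiples are stable under $D$,
  and $q$ behaves like a variable over the quotient: it is not a zero divisor there.  The proof
  differentiates $q^k f$ and multiplies by $q$ once more, which shows that $d$ divides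
  $q^{k+1} (D f)$ and, by induction on the order of nilpotency, $D f$; what is left of the derivative
  is a unit times $q^{k-1} f$, and $k$ can be lowered.  In the polynomial ring the statement is used
  for linear forms $q$, with $d = 0$ or $d$ a linear form that is not proportional to $q$.\<close>

lemma dvd_mult_cancel_linear:
  assumes rat: "\<And>j. of_nat (Suc j) dvd (1::'r)"
    and nilpotent: "(D ^^ N) f = 0"
    and d: "D d = 0" and q: "D q dvd 1"
    and dvd: "d dvd q ^ k * f"
  shows "d dvd f"
  using nilpotent dvd
proof (induction N arbitrary: f k)
  case (Suc N f k)
  \<comment> \<open>The exponent has to be generalized: the induction on N raises it.\<close>
  note outer = Suc.IH
  have nil: "(D ^^ N) (D f) = 0"
    using Suc.prems(1) by (simp add: funpow_swap1)
  from Suc.prems(2) show ?case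
  proof (induction k)
    case (Suc k)
    let ?u = "of_nat (Suc k) * D q"
    have D: "d dvd ?u * q ^ k * f + q ^ Suc k * D f"
      using dvd_D[OF d Suc.prems] by (simp only: D_power_mult) simp
    have "d dvd q * (?u * q ^ k * f + q ^ Suc k * D f) - ?u * (q ^ Suc k * f)"
      by (rule dvd_diff[OF dvd_mult[OF D] dvd_mult[OF Suc.prems]])
    then have "d dvd q ^ Suc (Suc k) * D f"
      by (simp add: algebra_simps)
    then have "d dvd D f"
      by (rule outer[OF nil])
    then have "d dvd (?u * q ^ k * f + q ^ Suc k * D f) - q ^ Suc k * D f"
      by (rule dvd_diff[OF D dvd_mult])
    then have *: "d dvd ?u * (q ^ k * f)"
      by (simp add: algebra_simps)
    have "?u dvd 1 * 1"
      using rat q by (intro mult_dvd_mono) auto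
    then obtain v where "1 = ?u * v"
      by (auto simp: dvd_def)
    then have "q ^ k * f = v * (?u * (q ^ k * f))"
      by (metis mult.assoc mult.commute mult_1)
    then have "d dvd q ^ k * f"
      using * by (metis dvd_mult)
    then show ?case
      by (rule Suc.IH)
  qed simp
qed simp

end


section \<open>Families of derivations dual to a family of ring elements\<close>

text \<open>The model is a generic arrangement of $k + m$ hyperplanes in $K^{k+1}$ with defining forms $p_H$,
  where $\delta_G$ is the derivative in the direction of the line in which the hyperplanes of $G$
  meet.  The arguments use that the polynomial ring is an algebra over the rationals, on which
  the $\delta_G$ are locally nilpotent.\<close>

locale dual_derivations =
  fixes \<A> :: "'h set" and k m :: nat
    and p :: "'h \<Rightarrow> 'r::comm_ring_1" and \<delta> :: "'h set \<Rightarrow> 'r \<Rightarrow> 'r"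
  assumes finite_A: "finite \<A>" and card_A: "card \<A> = k + m" and k_pos: "k \<ge> 1" and m_pos: "m \<ge> 1"
    and rat: "\<And>j. of_nat (Suc j) dvd (1::'r)"
    and deriv: "\<And>\<G>. \<G> \<in> [\<A>]\<^bsup>k\<^esup> \<Longrightarrow> derivation (\<delta> \<G>)"
    and nilpotent: "\<And>\<G> f. \<G> \<in> [\<A>]\<^bsup>k\<^esup> \<Longrightarrow> \<exists>N. (\<delta> \<G> ^^ N) f = 0"
    and annihilates: "\<And>\<G> H. \<G> \<in> [\<A>]\<^bsup>k\<^esup> \<Longrightarrow> H \<in> \<G> \<Longrightarrow> \<delta> \<G> (p H) = 0"
    and unit: "\<And>\<G> H. \<G> \<in> [\<A>]\<^bsup>k\<^esup> \<Longrightarrow> H \<in> \<A> - \<G> \<Longrightarrow> \<delta> \<G> (p H) dvd 1"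
    and linear: "\<And>\<G> \<G>' H. \<G> \<in> [\<A>]\<^bsup>k\<^esup> \<Longrightarrow> \<G>' \<in> [\<A>]\<^bsup>k\<^esup> \<Longrightarrow> H \<in> \<A> \<Longrightarrow> \<delta> \<G> (\<delta> \<G>' (p H)) = 0"
begin

lemma nsetsD: "\<G> \<subseteq> \<A>" "finite \<G>" "card \<G> = k" if "\<G> \<in> [\<A>]\<^bsup>k\<^esup>"
  using that by (auto simp: nsets_def)

lemma finite_nsets: "finite ([\<A>]\<^bsup>k\<^esup>)"
  using finite_A by (rule finite_imp_finite_nsets)

lemma card_complement: "card (\<A> - \<G>) = m" if "\<G> \<in> [\<A>]\<^bsup>k\<^esup>"
  using nsetsD[OF that] card_A by (simp add: card_Diff_subset)

lemma nsets_eqI: "\<G> = \<G>'" if "\<G> \<in> [\<A>]\<^bsup>k\<^esup>" "\<G>' \<in> [\<A>]\<^bsup>k\<^esup>" "\<G> \<subseteq> \<G>'"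
  using nsetsD[OF that(1)] nsetsD[OF that(2)] that(3) by (simp add: card_subset_eq)

lemma of_nat_unit: "of_nat j dvd (1::'r)" if "j > 0"
  using rat[of "j - 1"] that by simp

lemma unit_prod: "(\<Prod>i\<in>B. c i) dvd (1::'r)" if "\<And>i. i \<in> B \<Longrightarrow> c i dvd 1"
  using prod_dvd_prod[of B c "\<lambda>_. 1"] that by simp

lemma unit_mult_dvd_cancel:
  assumes "d dvd u * f" "u dvd (1::'r)"
  shows "d dvd f"
proof -
  obtain v where "1 = u * v"
    using assms(2) by (auto simp: dvd_def)
  then have "f = v * (u * f)"
    by (metis mult.assoc mult.commute mult_1)
  then show ?thesis
    using assms(1) by (metis dvd_mult)
qed

text \<open>The products of the forms outside $G$ are a dual family for the $\delta_G^m$, up to units.\<close>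

lemma pairing:
  assumes "\<G> \<in> [\<A>]\<^bsup>k\<^esup>" "\<G>' \<in> [\<A>]\<^bsup>k\<^esup>"
  shows "\<G> \<noteq> \<G>' \<Longrightarrow> (\<delta> \<G> ^^ m) (\<Prod>H\<in>\<A> - \<G>'. p H) = 0"
    and "(\<delta> \<G> ^^ m) (\<Prod>H\<in>\<A> - \<G>. p H) dvd 1"
proof -
  interpret derivation "\<delta> \<G>"
    using assms(1) by (rule deriv)
  have eq: "(\<delta> \<G> ^^ m) (\<Prod>H\<in>\<A> - \<H>. p H) = of_nat (fact m) * (\<Prod>H\<in>\<A> - \<H>. \<delta> \<G> (p H))"
    if "\<H> \<in> [\<A>]\<^bsup>k\<^esup>" for \<H>
    using D_funpow_prod_linear[of "\<A> - \<H>" p] linear[OF assms(1) assms(1)] finite_A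
      card_complement[OF that] by simp
  show "(\<delta> \<G> ^^ m) (\<Prod>H\<in>\<A> - \<G>'. p H) = 0" if "\<G> \<noteq> \<G>'"
  proof -
    have "\<not> \<G> \<subseteq> \<G>'"
      using that assms nsets_eqI by blast
    \<comment> \<open>The form of H is a factor of the product, and its derivative vanishes.\<close>
    then obtain H where "H \<in> \<G>" "H \<in> \<A> - \<G>'"
      using nsetsD(1)[OF assms(1)] by blast
    then have "(\<Prod>H\<in>\<A> - \<G>'. \<delta> \<G> (p H)) = 0"
      using finite_A annihilates[OF assms(1)] by (intro prod_zero) auto
    then show ?thesis
      by (simp add: eq[OF assms(2)])
  qed
  have "of_nat (fact m) * (\<Prod>H\<in>\<A> - \<G>. \<delta> \<G> (p H)) dvd 1 * 1"
    using unit[OF assms(1)] by (intro mult_dvd_mono of_nat_unit unit_prod) auto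
  then show "(\<delta> \<G> ^^ m) (\<Prod>H\<in>\<A> - \<G>. p H) dvd 1"
    by (simp only: eq[OF assms(1)] mult_1)
qed

lemma powers_independent:
  assumes "\<And>h. (\<Sum>\<G>\<in>[\<A>]\<^bsup>k\<^esup>. c \<G> * (\<delta> \<G> ^^ m) h) = 0" and \<G>: "\<G> \<in> [\<A>]\<^bsup>k\<^esup>"
  shows "c \<G> = 0"
proof -
  let ?q = "\<Prod>H\<in>\<A> - \<G>. p H"
  have "(\<Sum>\<G>'\<in>[\<A>]\<^bsup>k\<^esup>. c \<G>' * (\<delta> \<G>' ^^ m) ?q) = c \<G> * (\<delta> \<G> ^^ m) ?q"
    using \<G> finite_nsets by (subst sum.remove[OF finite_nsets \<G>]) (simp add: pairing(1))
  then have "0 dvd (\<delta> \<G> ^^ m) ?q * c \<G>"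
    using assms(1)[of ?q] by (simp add: mult.commute)
  then have "0 dvd c \<G>"
    using pairing(2)[OF \<G> \<G>] by (rule unit_mult_dvd_cancel)
  then show ?thesis
    by simp
qed

lemma not_zero_divisor: "f = 0" if "p H * f = 0" "H \<in> \<A>"
proof -
  have "k \<le> card (\<A> - {H})"
    using card_A m_pos finite_A that(2) by (simp add: card_Diff_singleton)
  then obtain \<G> where "\<G> \<subseteq> \<A> - {H}" "card \<G> = k" "finite \<G>"
    by (rule obtain_subset_with_card_n)
  then have \<G>: "\<G> \<in> [\<A>]\<^bsup>k\<^esup>" and H: "H \<in> \<A> - \<G>"
    using that(2) by (auto simp: nsets_def)
  obtain N where N: "(\<delta> \<G> ^^ N) f = 0"
    using nilpotent[OF \<G>] by blast
  have "0 dvd f"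
    using derivation.dvd_mult_cancel_linear[OF deriv[OF \<G>] rat N _ unit[OF \<G> H], of 0 1]
      that(1) derivation.D_0[OF deriv[OF \<G>]] by simp
  then show ?thesis by simp
qed

text \<open>A set $G$ containing $H$ but not $H'$ provides a derivation for which $p_H$ is constant and
  $p_{H'}$ is linear.\<close>

lemma coprime_forms: "p H dvd f" if "p H dvd p H' * f" "H \<in> \<A>" "H' \<in> \<A>" "H \<noteq> H'"
proof -
  have "k - 1 \<le> card (\<A> - {H, H'})"
    using card_A m_pos finite_A that by (simp add: card_Diff_subset)
  then obtain T where T: "T \<subseteq> \<A> - {H, H'}" "card T = k - 1" "finite T"
    by (rule obtain_subset_with_card_n)
  define \<G> where "\<G> = insert H T"
  have \<G>: "\<G> \<in> [\<A>]\<^bsup>k\<^esup>" and H': "H' \<in> \<A> - \<G>" and H: "H \<in> \<G>"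
    using T k_pos that(2-4) by (auto simp: nsets_def \<G>_def card_insert_if)
  obtain N where N: "(\<delta> \<G> ^^ N) f = 0"
    using nilpotent[OF \<G>] by blast
  show ?thesis
    using derivation.dvd_mult_cancel_linear[OF deriv[OF \<G>] rat N annihilates[OF \<G> H] unit[OF \<G> H'], of 1]
      that(1) by simp
qed

lemma prod_not_zero_divisor: "f = 0" if "(\<Prod>H\<in>B. p H) * f = 0" "B \<subseteq> \<A>"
proof -
  have "finite B"
    using that(2) finite_A by (rule finite_subset)
  then show ?thesis
    using that by (induction B) (auto simp: mult.assoc dest: not_zero_divisor)
qed

lemma coprime_form_prod:
  "p H dvd f" if "p H dvd (\<Prod>H\<in>B. p H) * f" "H \<in> \<A>" "B \<subseteq> \<A> - {H}"
proof -
  have "finite B"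
    using that(3) finite_A by (meson finite_Diff finite_subset)
  then show ?thesis
    using that by (induction B) (auto simp: mult.assoc dest: coprime_forms)
qed

text \<open>The forms are pairwise coprime: after division by a product of some of them, the quotient is
  still divisible by each of the others.\<close>

lemma prod_forms_dvd: "(\<Prod>H\<in>B. p H) dvd f" if "B \<subseteq> \<A>" "\<And>H. H \<in> B \<Longrightarrow> p H dvd f"
proof -
  have "finite B"
    using that(1) finite_A by (rule finite_subset)
  then show ?thesis
    using that
  proof (induction B)
    case (insert H B)
    then obtain g where g: "f = (\<Prod>H\<in>B. p H) * g"
      by (auto simp: dvd_def)
    have "p H dvd g"
      using insert.prems insert.hyps by (intro coprime_form_prod[of H B g]) (auto simp flip: g)
    then show ?case
      using insert.hyps by (auto simp: g dvd_def mult_ac)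
  qed simp
qed

text \<open>Commutators with multiplications preserve the multiples of $Q$.  Taking them with $p_H$ for all
  $H \in B$ lowers the order by $|B|$ and brings out the factors $\delta_G(p_H)$, along with an integer
  which is a unit and can be dropped.\<close>

lemma contract_symbol:
  assumes preserves: "\<And>h. Q dvd (\<Sum>\<G>\<in>[\<A>]\<^bsup>k\<^esup>. f \<G> * (\<delta> \<G> ^^ m) (Q * h))"
    and "B \<subseteq> \<A>" "card B \<le> m"
  shows "Q dvd (\<Sum>\<G>\<in>[\<A>]\<^bsup>k\<^esup>. f \<G> * (\<Prod>H\<in>B. \<delta> \<G> (p H)) * (\<delta> \<G> ^^ (m - card B)) (Q * h))"
proof -
  have "finite B"
    using assms(2) finite_A by (rule finite_subset)
  then show ?thesis
    using assms(2,3)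
  proof (induction B arbitrary: h)
    case empty
    then show ?case
      using preserves by simp
  next
    case (insert H B)
    define j where "j = m - card (insert H B)"
    have j: "m - card B = Suc j"
      using insert.prems insert.hyps by (simp add: j_def)
    let ?c = "\<lambda>\<G>. f \<G> * (\<Prod>H\<in>B. \<delta> \<G> (p H))"
    have arith: "x * y * (a * z + N * d * w) - a * (x * y * z) = N * (x * (d * y) * w)" for x y a z N d w :: 'r
      by (simp add: algebra_simps)
    have IH: "Q dvd (\<Sum>\<G>\<in>[\<A>]\<^bsup>k\<^esup>. ?c \<G> * (\<delta> \<G> ^^ Suc j) (Q * h))" for h
      using insert.IH insert.prems insert.hyps unfolding j by simp
    let ?T = "\<Sum>\<G>\<in>[\<A>]\<^bsup>k\<^esup>. f \<G> * (\<Prod>H\<in>insert H B. \<delta> \<G> (p H)) * (\<delta> \<G> ^^ j) (Q * h)"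
    have "(\<Sum>\<G>\<in>[\<A>]\<^bsup>k\<^esup>. ?c \<G> * (\<delta> \<G> ^^ Suc j) (Q * (p H * h)))
        - p H * (\<Sum>\<G>\<in>[\<A>]\<^bsup>k\<^esup>. ?c \<G> * (\<delta> \<G> ^^ Suc j) (Q * h)) = of_nat (Suc j) * ?T"
      (is "?L = _")
    proof -
      have "?c \<G> * (\<delta> \<G> ^^ Suc j) (Q * (p H * h)) - p H * (?c \<G> * (\<delta> \<G> ^^ Suc j) (Q * h))
        = of_nat (Suc j) * (f \<G> * (\<Prod>H\<in>insert H B. \<delta> \<G> (p H)) * (\<delta> \<G> ^^ j) (Q * h))"
        if "\<G> \<in> [\<A>]\<^bsup>k\<^esup>" for \<G>
      proof -
        have "(\<delta> \<G> ^^ Suc j) (Q * (p H * h)) = (\<delta> \<G> ^^ Suc j) (p H * (Q * h))"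
          by (simp only: mult.left_commute)
        also have "\<dots> = p H * (\<delta> \<G> ^^ Suc j) (Q * h)
            + of_nat (Suc j) * \<delta> \<G> (p H) * (\<delta> \<G> ^^ j) (Q * h)"
          using linear[OF that that] insert.prems
          by (intro derivation.D_funpow_mult_linear[OF deriv[OF that]]) auto
        finally have *: "(\<delta> \<G> ^^ Suc j) (Q * (p H * h)) = \<dots>" .
        show ?thesis
          unfolding * prod.insert[OF insert.hyps] by (rule arith)
      qed
      then show ?thesis
        by (simp only: sum_distrib_left sum_subtractf[symmetric] cong: sum.cong)
    qed
    moreover have "Q dvd ?L"
      using IH[of "p H * h"] IH[of h] by (intro dvd_diff dvd_mult)
    ultimately have "Q dvd of_nat (Suc j) * ?T"
      by simp
    then show ?case
      using rat unfolding j_def[symmetric] by (rule unit_mult_dvd_cancel)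
  qed
qed

text \<open>By \<open>prod_forms_dvd\<close> one form $p_H$ can be treated at a time.  The set $B$ below is chosen such
  that contraction with its forms leaves a derivation, and kills every $G'$ that is not
  contained in $G \cup \{H\}$.\<close>

theorem preserves_imp_dvd:
  assumes "\<A>\<^sub>0 \<subseteq> \<A>" and Q: "Q = (\<Prod>H\<in>\<A>\<^sub>0. p H)"
    and preserves: "\<And>h. Q dvd (\<Sum>\<G>\<in>[\<A>]\<^bsup>k\<^esup>. f \<G> * (\<delta> \<G> ^^ m) (Q * h))"
    and \<G>: "\<G> \<in> [\<A>]\<^bsup>k\<^esup>"
  shows "(\<Prod>H\<in>\<A>\<^sub>0 - \<G>. p H) dvd f \<G>"
proof (rule prod_forms_dvd)
  show "\<A>\<^sub>0 - \<G> \<subseteq> \<A>"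
    using assms(1) by blast
next
  fix H assume H: "H \<in> \<A>\<^sub>0 - \<G>"
  define B where "B = \<A> - \<G> - {H}"
  define Q' where "Q' = (\<Prod>H\<in>\<A>\<^sub>0 - {H}. p H)"
  have finite_A0: "finite \<A>\<^sub>0"
    using assms(1) finite_A by (rule finite_subset)
  have Q': "Q = p H * Q'"
    using H finite_A0 by (simp add: Q Q'_def prod.remove)
  have card_B: "m - card B = 1"
    using H assms(1) card_complement[OF \<G>] m_pos finite_A by (auto simp: B_def card_Diff_singleton)
  have B: "B \<subseteq> \<A>" "card B \<le> m"
    using card_B m_pos by (auto simp: B_def)
  let ?c = "\<lambda>\<G>. f \<G> * (\<Prod>H\<in>B. \<delta> \<G> (p H))"
  \<comment> \<open>The derivation that remains is evaluated at Q itself.\<close>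
  have "Q dvd (\<Sum>\<G>\<in>[\<A>]\<^bsup>k\<^esup>. ?c \<G> * \<delta> \<G> Q)"
    using contract_symbol[OF preserves B, of 1] by (simp add: card_B)
  then have *: "p H dvd (\<Sum>\<G>\<in>[\<A>]\<^bsup>k\<^esup>. ?c \<G> * \<delta> \<G> Q)"
    by (rule dvd_trans[rotated]) (simp add: Q')
  \<comment> \<open>Only the term of the given set can fail to be divisible by the form of H.\<close>
  have rest: "p H dvd ?c \<G>' * \<delta> \<G>' Q" if \<G>': "\<G>' \<in> [\<A>]\<^bsup>k\<^esup> - {\<G>}" for \<G>'
  proof (cases "\<G>' \<inter> B = {}")
    case False
    then obtain H' where H': "H' \<in> \<G>'" "H' \<in> B"
      by blast
    have "(\<Prod>H\<in>B. \<delta> \<G>' (p H)) = 0"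
      using H' \<G>' annihilates[of \<G>' H'] finite_A B_def by (intro prod_zero) auto
    then show ?thesis
      by simp
  next
    case True
    have "\<G>' \<subseteq> \<A>"
      using \<G>' nsetsD by blast
    then have "\<G>' \<subseteq> insert H \<G>"
      using True by (auto simp: B_def)
    moreover have "\<not> \<G>' \<subseteq> \<G>"
      using \<G>' \<G> nsets_eqI by blast
    ultimately have "H \<in> \<G>'"
      by blast
    then have "\<delta> \<G>' (p H) = 0"
      using \<G>' annihilates by blast
    then show ?thesis
      using \<G>' derivation.D_mult[OF deriv, of \<G>' "p H" Q'] by (simp add: Q')
  qed
  have "p H dvd (\<Sum>\<G>\<in>[\<A>]\<^bsup>k\<^esup>. ?c \<G> * \<delta> \<G> Q) - (\<Sum>\<G>\<in>[\<A>]\<^bsup>k\<^esup> - {\<G>}. ?c \<G> * \<delta> \<G> Q)"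
    by (rule dvd_diff[OF * dvd_sum[OF rest]])
  also have "\<dots> = ?c \<G> * \<delta> \<G> Q"
    using \<G> finite_nsets by (simp add: sum.remove)
  finally have "p H dvd ?c \<G> * \<delta> \<G> Q - p H * (?c \<G> * \<delta> \<G> Q')"
    by (intro dvd_diff) auto
  also have "\<dots> = ((\<Prod>H\<in>B. \<delta> \<G> (p H)) * \<delta> \<G> (p H)) * (Q' * f \<G>)"
    by (simp add: Q' derivation.D_mult[OF deriv[OF \<G>]] algebra_simps)
  finally have "p H dvd Q' * f \<G>"
  proof (rule unit_mult_dvd_cancel)
    have "(\<Prod>H\<in>B. \<delta> \<G> (p H)) * \<delta> \<G> (p H) dvd 1 * 1"
      using unit[OF \<G>] H assms(1) by (intro mult_dvd_mono unit_prod) (auto simp: B_def)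
    then show "(\<Prod>H\<in>B. \<delta> \<G> (p H)) * \<delta> \<G> (p H) dvd 1"
      by simp
  qed
  moreover have "H \<in> \<A>" "\<A>\<^sub>0 - {H} \<subseteq> \<A> - {H}"
    using H assms(1) by blast+
  ultimately show "p H dvd f \<G>"
    unfolding Q'_def by (rule coprime_form_prod)
qed

text \<open>The part of $Q$ made of forms from $G$ commutes with $\delta_G$, and the rest of $Q$ is the coefficient
  in front.\<close>

lemma dvd_imp_preserves:
  assumes "\<A>\<^sub>0 \<subseteq> \<A>" and \<G>: "\<G> \<in> [\<A>]\<^bsup>k\<^esup>"
  shows "(\<Prod>H\<in>\<A>\<^sub>0. p H) dvd (\<Prod>H\<in>\<A>\<^sub>0 - \<G>. p H) * (\<delta> \<G> ^^ m) ((\<Prod>H\<in>\<A>\<^sub>0. p H) * h)"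
proof -
  interpret derivation "\<delta> \<G>"
    using \<G> by (rule deriv)
  have "finite \<A>\<^sub>0"
    using assms(1) finite_A by (rule finite_subset)
  then have Q: "(\<Prod>H\<in>\<A>\<^sub>0. p H) = (\<Prod>H\<in>\<A>\<^sub>0 \<inter> \<G>. p H) * (\<Prod>H\<in>\<A>\<^sub>0 - \<G>. p H)"
    by (metis mult.commute prod.Int_Diff)
  have "\<delta> \<G> (\<Prod>H\<in>\<A>\<^sub>0 \<inter> \<G>. p H) = 0"
    using annihilates[OF \<G>] by (intro D_const_prod) auto
  then have "(\<delta> \<G> ^^ m) ((\<Prod>H\<in>\<A>\<^sub>0. p H) * h)
      = (\<Prod>H\<in>\<A>\<^sub>0 \<inter> \<G>. p H) * (\<delta> \<G> ^^ m) ((\<Prod>H\<in>\<A>\<^sub>0 - \<G>. p H) * h)"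
    unfolding Q mult.assoc by (rule D_funpow_const_mult)
  then show ?thesis
    unfolding Q by (metis dvd_triv_left mult.assoc mult.commute)
qed

end


section \<open>Directional derivatives of polynomials\<close>

lemma lookup_Const_mult [simp]:
  "Poly_Mapping.lookup (Const c * f) \<beta> = (c::'a::comm_ring_1) * Poly_Mapping.lookup f \<beta>"
  unfolding Const_def mult_map_scale_conv_mult[symmetric] by (simp add: Poly_Mapping.map.rep_eq when_def)

lemma Const_0 [simp]: "Const 0 = 0"
  by (simp add: Const_def)

lemma Const_eq_0_iff [simp]: "Const c = 0 \<longleftrightarrow> c = 0"
  by (metis Const_0 Const_def lookup_single_eq lookup_zero)

lemma Const_1 [simp]: "Const 1 = 1"
  by (simp add: Const_def)

lemma Const_add: "Const (a + b) = Const a + Const (b::'a::comm_ring_1)"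
  by (simp add: Const_def single_add)

lemma Const_mult: "Const (a * b) = Const a * Const (b::'a::comm_ring_1)"
  by (simp add: Const_def mult_single)

lemma Const_sum: "Const (\<Sum>i\<in>A. c i) = (\<Sum>i\<in>A. Const (c i :: 'a::comm_ring_1))"
  by (induction A rule: infinite_finite_induct) (simp_all add: Const_add)

lemma Const_dvd_1: "Const c dvd 1" if "(c::'a::field) \<noteq> 0"
  using that by (intro dvdI[of _ _ "Const (inverse c)"]) (simp flip: Const_mult)

lemma of_nat_dvd_1: "of_nat (Suc j) dvd (1 :: ('n, 'a::field_char_0) mpoly)"
  using Const_dvd_1[OF of_nat_neq_0, of j] by (simp add: Const_def del: of_nat_Suc)

text \<open>Additive identities, such as the Leibniz rule as an identity in either factor, have to be checked
  on monomials only.\<close>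

lemma additive_eqI:
  fixes F G :: "('k \<Rightarrow>\<^sub>0 'b::comm_monoid_add) \<Rightarrow> 'c::cancel_comm_monoid_add"
  assumes F: "\<And>f g. F (f + g) = F f + F g" and G: "\<And>f g. G (f + g) = G f + G g"
    and eq: "\<And>k c. F (Poly_Mapping.single k c) = G (Poly_Mapping.single k c)"
  shows "F f = G f"
proof (induction f rule: update_induct)
  case const
  show ?case
    using F[of 0 0] G[of 0 0] by simp
next
  case (update f k c)
  have "Poly_Mapping.update k c f = f + Poly_Mapping.single k c"
    using update.hyps
    by (intro poly_mapping_eqI) (auto simp: lookup_update lookup_add lookup_single in_keys_iff when_def)
  then show ?case
    using update by (simp add: F G eq)
qed

lemma partial_add: "partial i (f + g) = partial i f + partial i g"
  by (intro poly_mapping_eqI) (simp add: lookup_partial lookup_add algebra_simps)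

lemma partial_0 [simp]: "partial i 0 = 0"
  by (intro poly_mapping_eqI) (simp add: lookup_partial)

lemma partial_Const_mult: "partial i (Const c * f) = Const c * partial i f"
  by (intro poly_mapping_eqI) (simp add: lookup_partial mult.left_commute)

lemma partial_single:
  "partial i (Poly_Mapping.single \<alpha> c) =
     Poly_Mapping.single (\<alpha> - Poly_Mapping.single i 1) (of_nat (Poly_Mapping.lookup \<alpha> i) * c)"
  by (cases "c = 0") (simp_all add: partial_def)

lemma partial_mult_single:
  fixes c d :: "'a::comm_ring_1"
  shows "partial i (Poly_Mapping.single \<alpha> c * Poly_Mapping.single \<beta> d) =
    partial i (Poly_Mapping.single \<alpha> c) * Poly_Mapping.single \<beta> d
    + Poly_Mapping.single \<alpha> c * partial i (Poly_Mapping.single \<beta> d)"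
proof -
  \<comment> \<open>Where the subtraction truncates and the shift fails, the coefficient below is zero.\<close>
  have shift: "\<alpha> - Poly_Mapping.single i 1 + \<beta> = \<alpha> + \<beta> - Poly_Mapping.single i (1::nat)"
    if "Poly_Mapping.lookup \<alpha> i \<noteq> 0" for \<alpha> \<beta> :: "'b \<Rightarrow>\<^sub>0 nat"
    using that by (intro poly_mapping_eqI) (auto simp: lookup_add lookup_minus lookup_single when_def)
  have "Poly_Mapping.single (\<alpha> - Poly_Mapping.single i 1 + \<beta>) (of_nat (Poly_Mapping.lookup \<alpha> i) * c * d)
    = Poly_Mapping.single (\<alpha> + \<beta> - Poly_Mapping.single i 1) (of_nat (Poly_Mapping.lookup \<alpha> i) * c * d)"
    using shift[of \<alpha> \<beta>] by (cases "Poly_Mapping.lookup \<alpha> i = 0") simp_all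
  moreover have "Poly_Mapping.single (\<alpha> + (\<beta> - Poly_Mapping.single i 1)) (of_nat (Poly_Mapping.lookup \<beta> i) * c * d)
    = Poly_Mapping.single (\<alpha> + \<beta> - Poly_Mapping.single i 1) (of_nat (Poly_Mapping.lookup \<beta> i) * c * d)"
    using shift[of \<beta> \<alpha>] by (cases "Poly_Mapping.lookup \<beta> i = 0") (simp_all add: add.commute)
  ultimately show ?thesis
    by (simp add: partial_single mult_single lookup_add algebra_simps flip: single_add)
qed

lemma partial_mult: "partial i (f * g) = partial i f * g + f * partial i g"
proof (rule additive_eqI[where f = f])
  fix \<alpha> and c :: 'b
  show "partial i (Poly_Mapping.single \<alpha> c * g) =
      partial i (Poly_Mapping.single \<alpha> c) * g + Poly_Mapping.single \<alpha> c * partial i g"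
    by (rule additive_eqI[where f = g]) (simp_all add: partial_mult_single partial_add algebra_simps)
qed (simp_all add: partial_add algebra_simps)

lemma partial_Const [simp]: "partial i (Const c) = 0"
  by (simp add: Const_def partial_single)

lemma partial_Var: "partial i (Var j) = (if i = j then 1 else 0)"
  by (simp add: Var_def partial_single lookup_single when_def)

definition linear_form :: "'a::comm_ring_1 ^ 'n::finite \<Rightarrow> ('n, 'a) mpoly"
  where "linear_form b = (\<Sum>i\<in>UNIV. Const (b $ i) * Var i)"

definition directional :: "'a::comm_ring_1 ^ 'n::finite \<Rightarrow> ('n, 'a) op"
  where "directional a = (\<Sum>i\<in>UNIV. Const (a $ i) \<cdot>\<^sub>S partial i)"

lemma sum_fun_apply: "(\<Sum>i\<in>A. F i) x = (\<Sum>i\<in>A. F i x)"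
  by (induction A rule: infinite_finite_induct) simp_all

lemma directional_apply: "directional a f = (\<Sum>i\<in>UNIV. Const (a $ i) * partial i f)"
  by (simp add: directional_def sum_fun_apply op_scale_def)

lemma derivation_directional: "derivation (directional a)"
  by unfold_locales
    (simp_all add: directional_apply partial_add partial_mult algebra_simps sum.distrib
      sum_distrib_left sum_distrib_right)

lemma partial_linear_form: "partial i (linear_form b) = Const (b $ i)"
proof -
  have "partial i (\<Sum>j\<in>A. Const (b $ j) * Var j) = (\<Sum>j\<in>A. if i = j then Const (b $ i) else 0)"
    if "finite A" for A
    using that by (induction A) (auto simp: partial_add partial_Const_mult partial_Var)
  then show ?thesis
    by (simp add: linear_form_def)
qed

lemma directional_linear_form: "directional a (linear_form b) = Const (\<Sum>i\<in>UNIV. a $ i * b $ i)"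
  by (simp add: directional_apply partial_linear_form Const_sum Const_mult)

lemma directional_Const [simp]: "directional a (Const c) = 0"
  by (simp add: directional_apply)

lemma eval_mpoly_linear_form: "eval_mpoly v (linear_form b) = (\<Sum>i\<in>UNIV. v $ i * b $ i)"
proof -
  let ?x = "\<lambda>i. Poly_Mapping.single i (1::nat)"
  have inj: "inj ?x"
    by (rule injI) (metis lookup_single_eq lookup_single_not_eq zero_neq_one)
  have lookup: "Poly_Mapping.lookup (linear_form b) \<alpha> = (\<Sum>i\<in>UNIV. b $ i when ?x i = \<alpha>)" for \<alpha>
    by (simp add: linear_form_def lookup_sum Var_def lookup_single mult_when)
  have lookup_x: "Poly_Mapping.lookup (linear_form b) (?x i) = b $ i" for i
    unfolding lookup inj_eq[OF inj] by (simp add: when_def)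
  have keys: "Poly_Mapping.keys (linear_form b) \<subseteq> range ?x"
  proof
    fix \<alpha> assume "\<alpha> \<in> Poly_Mapping.keys (linear_form b)"
    then have "(\<Sum>i\<in>UNIV. b $ i when ?x i = \<alpha>) \<noteq> 0"
      unfolding in_keys_iff lookup .
    then obtain i where "(b $ i when ?x i = \<alpha>) \<noteq> 0"
      by (rule sum.not_neutral_contains_not_neutral)
    then show "\<alpha> \<in> range ?x"
      by auto
  qed
  have "eval_mpoly v (linear_form b) = (\<Sum>\<alpha>\<in>range ?x. Poly_Mapping.lookup (linear_form b) \<alpha> *
      (\<Prod>i\<in>UNIV. (v $ i) ^ Poly_Mapping.lookup \<alpha> i))"
    unfolding eval_mpoly_def using keys by (intro sum.mono_neutral_left) (auto simp: in_keys_iff)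
  also have "\<dots> = (\<Sum>j\<in>UNIV. b $ j * (\<Prod>i\<in>UNIV. (v $ i) ^ Poly_Mapping.lookup (?x j) i))"
    unfolding sum.reindex[OF inj] comp_def lookup_x ..
  also have "\<dots> = (\<Sum>j\<in>UNIV. b $ j * v $ j)"
    by (simp add: lookup_single when_def if_distrib prod.delta cong: if_cong)
  finally show ?thesis
    by (simp add: mult.commute)
qed

abbreviation total_degree :: "('n::finite \<Rightarrow>\<^sub>0 nat) \<Rightarrow> nat"
  where "total_degree \<alpha> \<equiv> \<Sum>i\<in>UNIV. Poly_Mapping.lookup \<alpha> i"

lemma total_degree_Suc: "total_degree (\<alpha> + Poly_Mapping.single i 1) = Suc (total_degree \<alpha>)"
  by (simp add: lookup_add lookup_single sum.distrib when_def)

text \<open>A directional derivative lowers the total degree.\<close>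

lemma directional_nilpotent: "\<exists>N. (directional a ^^ N) f = 0"
proof -
  have vanish: "(directional a ^^ N) f = 0"
    if "\<And>\<beta>. N \<le> total_degree \<beta> \<Longrightarrow> Poly_Mapping.lookup f \<beta> = 0" for N f
    using that
  proof (induction N arbitrary: f)
    case 0
    then show ?case
      by (simp add: poly_mapping_eqI)
  next
    case (Suc N)
    have "Poly_Mapping.lookup (directional a f) \<beta> = 0" if "N \<le> total_degree \<beta>" for \<beta>
    proof -
      have "Poly_Mapping.lookup f (\<beta> + Poly_Mapping.single i 1) = 0" for i
        using that by (intro Suc.prems) (simp only: total_degree_Suc)
      then show ?thesis
        by (simp add: directional_apply lookup_sum lookup_partial)
    qed
    then show ?case
      by (simp add: funpow_swap1 Suc.IH)
  qed
  define N where "N = Suc (\<Sum>\<alpha>\<in>Poly_Mapping.keys f. total_degree \<alpha>)"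
  have "Poly_Mapping.lookup f \<beta> = 0" if "N \<le> total_degree \<beta>" for \<beta>
  proof (rule ccontr)
    assume "Poly_Mapping.lookup f \<beta> \<noteq> 0"
    then have "total_degree \<beta> \<le> (\<Sum>\<alpha>\<in>Poly_Mapping.keys f. total_degree \<alpha>)"
      by (intro member_le_sum) (auto simp: in_keys_iff)
    then show False
      using that by (simp add: N_def)
  qed
  then show ?thesis
    using vanish by blast
qed

section \<open>Constant-coefficient operators\<close>

interpretation const_op: vector_space
  "\<lambda>(c::'a::field) (\<theta> :: ('n, 'a) op). Const c \<cdot>\<^sub>S \<theta>"
  by unfold_locales (simp_all add: op_scale_def fun_eq_iff Const_add Const_mult algebra_simps)

text \<open>Adjoining to $S$ an element of $T$ outside its span would give an independent subset of the span of
  $T$ with more than $|T|$ elements.\<close>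

lemma (in vector_space) independent_card_ge_imp_span:
  assumes "finite T" "independent S" "S \<subseteq> span T" "card T \<le> card S"
  shows "T \<subseteq> span S"
proof
  fix x assume x: "x \<in> T"
  have S: "finite S"
    using independent_span_bound[OF assms(1-3)] by blast
  show "x \<in> span S"
  proof (rule ccontr)
    assume x_notin: "x \<notin> span S"
    then have "independent (insert x S)"
      using assms(2) by (rule independent_insertI)
    moreover have "insert x S \<subseteq> span T"
      using assms(3) x by (simp add: span_base)
    ultimately have "card (insert x S) \<le> card T"
      using assms(1) independent_span_bound by blast
    moreover have "x \<notin> S"
      using x_notin span_base by blast
    ultimately show False
      using S assms(4) by simp
  qed
qed

definition monomial_ops :: "nat \<Rightarrow> ('n::finite, 'a::comm_ring_1) op set"
  where "monomial_ops m = {\<partial>\<^sup>\<alpha> | \<alpha>. total_degree \<alpha> = m}"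

text \<open>The defining fold of $\partial^\alpha$ over all variables is accessible to induction after
  generalizing it to a set of variables.\<close>

lemma fold_partial_insert:
  fixes \<alpha> :: "'n::finite \<Rightarrow>\<^sub>0 nat"
  defines "monom_on \<equiv> Finite_Set.fold (\<lambda>i (\<theta> :: ('n, 'a::comm_ring_1) op).
    (partial i ^^ Poly_Mapping.lookup \<alpha> i) \<circ> \<theta>) id"
  assumes "j \<notin> A"
  shows "monom_on (insert j A) = (partial j ^^ Poly_Mapping.lookup \<alpha> j) \<circ> monom_on A"
  unfolding monom_on_def using assms(2)
  by (intro comp_fun_commute_on.fold_insert[OF comp_fun_commute_partial[unfolded comp_fun_commute_def']])
    simp_all

lemma partial_monom_0: "\<partial>\<^sup>0 = (id :: ('n::finite, 'a::comm_ring_1) op)"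
proof -
  have "Finite_Set.fold (\<lambda>i (\<theta> :: ('n, 'a) op). (partial i ^^ Poly_Mapping.lookup 0 i) \<circ> \<theta>) id A = id"
    for A :: "'n set"
  proof (induction A rule: finite_induct[OF finite])
    case (2 i A)
    then show ?case
      unfolding fold_partial_insert[OF 2(2)] 2(3) by simp
  qed simp
  then show ?thesis
    by (simp only: partial_monom_def)
qed

lemma partial_comp_partial_monom:
  "partial i \<circ> \<partial>\<^sup>\<alpha> = (\<partial>\<^sup>(\<alpha> + Poly_Mapping.single i 1) :: ('n::finite, 'a::comm_ring_1) op)"
proof -
  let ?fold = "\<lambda>\<alpha> A. Finite_Set.fold (\<lambda>i (\<theta> :: ('n, 'a) op). (partial i ^^ Poly_Mapping.lookup \<alpha> i) \<circ> \<theta>) id A"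
  let ?\<alpha>' = "\<alpha> + Poly_Mapping.single i 1"
  have commute: "(partial j ^^ l) (partial i f) = partial i ((partial j ^^ l) f)" for j l and f :: "('n, 'a) mpoly"
    by (induction l) (simp_all add: partial_commute[of j i])
  have "?fold ?\<alpha>' A = (if i \<in> A then partial i \<circ> ?fold \<alpha> A else ?fold \<alpha> A)" for A
  proof (induction A rule: finite_induct[OF finite])
    case (2 j A)
    show ?case
      unfolding fold_partial_insert[OF 2(2)] 2(3) using 2(2)
      by (auto simp: lookup_add lookup_single fun_eq_iff commute when_def)
  qed simp
  then show ?thesis
    by (simp only: partial_monom_def) simp
qed

lemma directional_comp_span:
  fixes \<theta> :: "('n::finite, 'a::field) op"
  assumes "\<theta> \<in> const_op.span (monomial_ops m)"
  shows "directional a \<circ> \<theta> \<in> const_op.span (monomial_ops (Suc m))"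
  using assms
proof (induction rule: const_op.span_induct_alt)
  case base
  have "directional a \<circ> 0 = (0 :: ('n, 'a) op)"
    by (simp add: fun_eq_iff directional_apply)
  then show ?case
    by (simp only: const_op.span_zero)
next
  case (step c \<theta> \<eta>)
  obtain \<alpha> where \<alpha>: "\<theta> = \<partial>\<^sup>\<alpha>" "total_degree \<alpha> = m"
    using step.hyps by (auto simp: monomial_ops_def)
  have "directional a \<circ> \<theta> = (\<Sum>i\<in>UNIV. Const (a $ i) \<cdot>\<^sub>S (partial i \<circ> \<theta>))"
    by (simp add: fun_eq_iff directional_apply sum_fun_apply op_scale_def)
  also have "\<dots> \<in> const_op.span (monomial_ops (Suc m))"
  proof (intro const_op.span_sum const_op.span_scale const_op.span_base)
    show "partial i \<circ> \<theta> \<in> monomial_ops (Suc m)" for i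
      unfolding \<alpha>(1) partial_comp_partial_monom monomial_ops_def
      using total_degree_Suc[of \<alpha> i] \<alpha>(2) by blast
  qed
  finally have "Const c \<cdot>\<^sub>S (directional a \<circ> \<theta>) + (directional a \<circ> \<eta>)
      \<in> const_op.span (monomial_ops (Suc m))"
    using step.IH by (intro const_op.span_add const_op.span_scale)
  moreover have "directional a \<circ> (Const c \<cdot>\<^sub>S \<theta> + \<eta>)
      = Const c \<cdot>\<^sub>S (directional a \<circ> \<theta>) + (directional a \<circ> \<eta>)"
    by (simp add: fun_eq_iff op_scale_def directional_apply partial_add partial_Const_mult
        algebra_simps sum.distrib sum_distrib_left)
  ultimately show ?case
    by (simp only:)
qed

lemma directional_power_span:
  "directional a ^^ m \<in> const_op.span (monomial_ops m :: ('n::finite, 'a::field) op set)"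
proof (induction m)
  case 0
  have "id \<in> (monomial_ops 0 :: ('n, 'a) op set)"
    unfolding monomial_ops_def by (intro CollectI exI[of _ 0]) (simp add: partial_monom_0)
  then show ?case
    unfolding funpow_0 by (auto intro!: const_op.span_base simp: id_def)
next
  case (Suc m)
  then show ?case
    unfolding funpow.simps by (rule directional_comp_span)
qed

text \<open>Exponent vectors of total degree $m$ are multisets of $m$ variables, and these are counted in
  \<open>card_multisets_of_size\<close>.\<close>

lemma card_monomial_ops:
  "finite (monomial_ops m :: ('n::finite, 'a::comm_ring_1) op set)"
  "card (monomial_ops m :: ('n::finite, 'a::comm_ring_1) op set) \<le> (CARD('n) + m - 1) choose m"
proof -
  let ?M = "multisets_of_size (UNIV :: 'n set) m"
  have sub: "monomial_ops m \<subseteq> (\<lambda>M. \<partial>\<^sup>(Abs_poly_mapping (count M)) :: ('n, 'a) op) ` ?M"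
  proof
    fix \<theta> :: "('n, 'a) op" assume "\<theta> \<in> monomial_ops m"
    then obtain \<alpha> where \<alpha>: "\<theta> = \<partial>\<^sup>\<alpha>" "total_degree \<alpha> = m"
      by (auto simp: monomial_ops_def)
    define M where "M = Abs_multiset (Poly_Mapping.lookup \<alpha>)"
    have M: "count M = Poly_Mapping.lookup \<alpha>"
      unfolding M_def by (rule Abs_multiset_inverse) simp
    have "size M = (\<Sum>i\<in>UNIV. count M i)"
      unfolding size_multiset_overloaded_eq by (intro sum.mono_neutral_left) (auto simp: not_in_iff)
    then have "M \<in> ?M"
      using \<alpha> M by (simp add: multisets_of_size_def)
    then show "\<theta> \<in> (\<lambda>M. \<partial>\<^sup>(Abs_poly_mapping (count M))) ` ?M"
      using \<alpha>(1) M by (auto simp: poly_mapping.lookup_inverse intro!: image_eqI[of _ _ M])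
  qed
  have fin: "finite ?M"
    by (rule finite_multisets_of_size) simp
  show "finite (monomial_ops m :: ('n, 'a) op set)"
    using sub fin by (rule finite_surj[rotated])
  show "card (monomial_ops m :: ('n, 'a) op set) \<le> (CARD('n) + m - 1) choose m"
    using surj_card_le[OF fin sub] by (simp add: card_multisets_of_size)
qed


section \<open>The basis of the operators preserving the arrangement\<close>

locale dual_directional = dual_derivations \<A> k m p \<delta>
  for \<A> :: "('a::field_char_0 ^ 'n::finite) set set" and k m
    and p :: "('a ^ 'n) set \<Rightarrow> ('n, 'a) mpoly" and \<delta> +
  assumes k: "Suc k = CARD('n)"
    and directional: "\<And>\<G>. \<G> \<in> [\<A>]\<^bsup>k\<^esup> \<Longrightarrow> \<delta> \<G> \<in> range directional"
begin

lemma inj_on_powers: "inj_on (\<lambda>\<G>. \<delta> \<G> ^^ m) ([\<A>]\<^bsup>k\<^esup>)"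
proof (rule inj_onI, rule ccontr)
  fix \<G> \<G>' assume *: "\<G> \<in> [\<A>]\<^bsup>k\<^esup>" "\<G>' \<in> [\<A>]\<^bsup>k\<^esup>" "\<delta> \<G> ^^ m = \<delta> \<G>' ^^ m" "\<G> \<noteq> \<G>'"
  then show False
    using pairing(1)[of \<G> \<G>'] pairing(2)[of \<G>' \<G>'] by simp
qed

lemma powers_const_independent: "const_op.independent ((\<lambda>\<G>. \<delta> \<G> ^^ m) ` [\<A>]\<^bsup>k\<^esup>)"
proof
  assume "const_op.dependent ((\<lambda>\<G>. \<delta> \<G> ^^ m) ` [\<A>]\<^bsup>k\<^esup>)"
  from iffD1[OF const_op.dependent_finite[OF finite_imageI[OF finite_nsets]] this]
  obtain u where "\<exists>\<theta>\<in>(\<lambda>\<G>. \<delta> \<G> ^^ m) ` [\<A>]\<^bsup>k\<^esup>. u \<theta> \<noteq> 0"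
    and 0: "(\<Sum>\<theta>\<in>(\<lambda>\<G>. \<delta> \<G> ^^ m) ` [\<A>]\<^bsup>k\<^esup>. Const (u \<theta>) \<cdot>\<^sub>S \<theta>) = 0"
    by (elim exE conjE)
  then obtain \<G> where \<G>: "\<G> \<in> [\<A>]\<^bsup>k\<^esup>" "u (\<delta> \<G> ^^ m) \<noteq> 0"
    by blast
  have "(\<Sum>\<G>\<in>[\<A>]\<^bsup>k\<^esup>. Const (u (\<delta> \<G> ^^ m)) * (\<delta> \<G> ^^ m) h) = 0" for h
    using fun_cong[OF 0, of h]
    unfolding sum.reindex[OF inj_on_powers] comp_def sum_fun_apply op_scale_def zero_fun_apply .
  then have "Const (u (\<delta> \<G> ^^ m)) = (0 :: ('n, 'a) mpoly)"
    using \<G>(1) by (rule powers_independent)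
  then show False
    using \<G>(2) by simp
qed

text \<open>The $\delta_G^m$ lie in the $K$-span of the monomial operators $\partial^\alpha$ of order $m$ and are
  independent over $K$.  Both families consist of at most, respectively exactly,
  $\binom{k+m}{k}$ elements, and therefore have the same span over $K$, hence over $S$.\<close>

lemma ops_of_order_eq: "ops_of_order m = diffop.span ((\<lambda>\<G>. \<delta> \<G> ^^ m) ` [\<A>]\<^bsup>k\<^esup>)"
  (is "_ = diffop.span ?S")
proof
  have S: "?S \<subseteq> const_op.span (monomial_ops m)"
  proof (rule image_subsetI)
    fix \<G> assume "\<G> \<in> [\<A>]\<^bsup>k\<^esup>"
    then obtain a where "\<delta> \<G> = directional a"
      using directional by blast
    then show "\<delta> \<G> ^^ m \<in> const_op.span (monomial_ops m)"
      using directional_power_span by (simp only:)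
  qed
  have const_span: "const_op.span X \<subseteq> diffop.span X" for X :: "('n, 'a) op set"
    by (rule const_op.span_minimal)
      (auto simp: const_op.subspace_def intro: diffop.span_base diffop.span_zero diffop.span_add
        diffop.span_scale)
  have "card (monomial_ops m :: ('n, 'a) op set) \<le> (CARD('n) + m - 1) choose m"
    by (rule card_monomial_ops)
  also have "\<dots> = (k + m) choose k"
    using k by (metis add_diff_cancel_left' binomial_symmetric add_Suc diff_Suc_1 le_add1)
  also have "\<dots> = card ?S"
  proof -
    have "[\<A>]\<^bsup>k\<^esup> = {\<G>. \<G> \<subseteq> \<A> \<and> card \<G> = k}"
      using finite_A by (auto simp: nsets_def intro: finite_subset)
    then show ?thesis
      using n_subsets[OF finite_A, of k] card_A unfolding card_image[OF inj_on_powers] by simp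
  qed
  finally have "monomial_ops m \<subseteq> const_op.span ?S"
    by (rule const_op.independent_card_ge_imp_span[OF card_monomial_ops(1) powers_const_independent S])
  then show "ops_of_order m \<subseteq> diffop.span ?S"
    unfolding ops_of_order_def monomial_ops_def[symmetric]
    by (intro diffop.span_minimal[OF _ diffop.subspace_span] subset_trans[OF _ const_span])
  show "diffop.span ?S \<subseteq> ops_of_order m"
    unfolding ops_of_order_def monomial_ops_def[symmetric]
    by (rule diffop.span_minimal[OF subset_trans[OF S const_span] diffop.subspace_span])
qed

end

lemma op_scale_apply: "(f \<cdot>\<^sub>S \<theta>) g = f * \<theta> g"
  by (simp add: op_scale_def)

lemma weyl_zero: "(0 :: ('n, 'a::comm_ring_1) op) \<in> weyl_algebra"
proof -
  have *: "(0 :: ('n, 'a) op) = (\<lambda>g. 0 * g)"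
    by (simp add: fun_eq_iff)
  show ?thesis
    by (subst *) (rule weyl_algebra.mult)
qed

lemma weyl_scale: "f \<cdot>\<^sub>S \<theta> \<in> weyl_algebra" if "\<theta> \<in> weyl_algebra"
  using weyl_algebra.comp[OF weyl_algebra.mult[of f] that] by (simp add: op_scale_def comp_def)

lemma weyl_sum: "(\<Sum>i\<in>A. F i) \<in> weyl_algebra" if "\<And>i. i \<in> A \<Longrightarrow> F i \<in> weyl_algebra"
  using that
  by (induction A rule: infinite_finite_induct) (simp_all add: weyl_zero weyl_algebra.add)

lemma directional_power_weyl:
  fixes a :: "'a::comm_ring_1 ^ 'n::finite"
  shows "directional a ^^ m \<in> weyl_algebra"
proof (induction m)
  case 0
  then show ?case
  proof -
    have *: "(id :: ('n, 'a) op) = (\<lambda>g. 1 * g)"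
      by (simp add: fun_eq_iff)
    show ?thesis
      unfolding funpow.simps by (subst *) (rule weyl_algebra.mult)
  qed
next
  case (Suc m)
  have "directional a \<in> weyl_algebra"
    unfolding directional_def by (intro weyl_sum weyl_scale weyl_algebra.partial)
  then show ?case
    using Suc unfolding funpow.simps by (rule weyl_algebra.comp)
qed

lemma arrangement_ops_iff:
  "\<theta> \<in> arrangement_ops p \<A> \<longleftrightarrow>
    \<theta> \<in> weyl_algebra \<and> (\<forall>h. (\<Prod>H\<in>\<A>. p H) dvd \<theta> ((\<Prod>H\<in>\<A>. p H) * h))"
  unfolding arrangement_ops_def Let_def by (auto simp: dvd_def image_subset_iff)

lemma subspace_arrangement_ops_of_order: "diffop.subspace (arrangement_ops_of_order p m \<A>)"
proof -
  have "diffop.subspace (arrangement_ops p \<A>)"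
    by (rule diffop.subspaceI)
      (auto simp: arrangement_ops_iff weyl_zero weyl_scale weyl_algebra.add op_scale_apply)
  then show ?thesis
    unfolding arrangement_ops_of_order_def ops_of_order_def
    by (intro diffop.subspace_inter diffop.subspace_span)
qed

context dual_directional
begin

definition basis_op :: "('a ^ 'n) set set \<Rightarrow> ('a ^ 'n) set set \<Rightarrow> ('n, 'a) op"
  where "basis_op \<A>\<^sub>0 \<G> = (\<Prod>H\<in>\<A>\<^sub>0 - \<G>. p H) \<cdot>\<^sub>S (\<delta> \<G> ^^ m)"

lemma inj_on_basis_op: "inj_on (basis_op \<A>\<^sub>0) ([\<A>]\<^bsup>k\<^esup>)" if "\<A>\<^sub>0 \<subseteq> \<A>"
proof (rule inj_onI, rule ccontr)
  fix \<G> \<G>' assume *: "\<G> \<in> [\<A>]\<^bsup>k\<^esup>" "\<G>' \<in> [\<A>]\<^bsup>k\<^esup>" "basis_op \<A>\<^sub>0 \<G> = basis_op \<A>\<^sub>0 \<G>'" "\<G> \<noteq> \<G>'"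
  let ?q = "\<Prod>H\<in>\<A> - \<G>. p H"
  have "(\<Prod>H\<in>\<A>\<^sub>0 - \<G>. p H) * (\<delta> \<G> ^^ m) ?q = 0"
    using fun_cong[OF *(3), of ?q] pairing(1)[OF *(2,1)] *(4) by (simp add: basis_op_def op_scale_def)
  then have "(\<delta> \<G> ^^ m) ?q = 0"
    by (rule prod_not_zero_divisor) (use that in blast)
  then show False
    using pairing(2)[OF *(1,1)] by simp
qed

lemma basis_op_independent:
  assumes "\<A>\<^sub>0 \<subseteq> \<A>"
  shows "diffop.independent (basis_op \<A>\<^sub>0 ` [\<A>]\<^bsup>k\<^esup>)"
proof
  assume "diffop.dependent (basis_op \<A>\<^sub>0 ` [\<A>]\<^bsup>k\<^esup>)"
  from iffD1[OF diffop.dependent_finite[OF finite_imageI[OF finite_nsets]] this]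
  obtain u where "\<exists>\<theta>\<in>basis_op \<A>\<^sub>0 ` [\<A>]\<^bsup>k\<^esup>. u \<theta> \<noteq> 0"
    and 0: "(\<Sum>\<theta>\<in>basis_op \<A>\<^sub>0 ` [\<A>]\<^bsup>k\<^esup>. u \<theta> \<cdot>\<^sub>S \<theta>) = 0"
    by (elim exE conjE)
  then obtain \<G> where \<G>: "\<G> \<in> [\<A>]\<^bsup>k\<^esup>" "u (basis_op \<A>\<^sub>0 \<G>) \<noteq> 0"
    by blast
  have "(\<Sum>\<G>\<in>[\<A>]\<^bsup>k\<^esup>. ((\<Prod>H\<in>\<A>\<^sub>0 - \<G>. p H) * u (basis_op \<A>\<^sub>0 \<G>)) * (\<delta> \<G> ^^ m) h) = 0" for h
  proof -
    have "(\<Sum>\<G>\<in>[\<A>]\<^bsup>k\<^esup>. u (basis_op \<A>\<^sub>0 \<G>) * basis_op \<A>\<^sub>0 \<G> h) = 0"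
      using fun_cong[OF 0, of h]
      unfolding sum.reindex[OF inj_on_basis_op[OF assms]] comp_def sum_fun_apply op_scale_def zero_fun_apply .
    moreover have "(\<Prod>H\<in>\<A>\<^sub>0 - \<G>. p H) * u (basis_op \<A>\<^sub>0 \<G>) * (\<delta> \<G> ^^ m) h
        = u (basis_op \<A>\<^sub>0 \<G>) * basis_op \<A>\<^sub>0 \<G> h" for \<G>
      unfolding basis_op_def[of _ \<G>] op_scale_def by (simp only: mult_ac)
    ultimately show ?thesis
      by (simp only:)
  qed
  then have "(\<Prod>H\<in>\<A>\<^sub>0 - \<G>. p H) * u (basis_op \<A>\<^sub>0 \<G>) = 0"
    using \<G>(1) by (rule powers_independent)
  then have "u (basis_op \<A>\<^sub>0 \<G>) = 0"
    by (rule prod_not_zero_divisor) (use assms in blast)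
  then show False
    using \<G>(2) by simp
qed

lemma basis_op_in:
  assumes "\<A>\<^sub>0 \<subseteq> \<A>" and \<G>: "\<G> \<in> [\<A>]\<^bsup>k\<^esup>"
  shows "basis_op \<A>\<^sub>0 \<G> \<in> arrangement_ops_of_order p m \<A>\<^sub>0"
proof -
  obtain a where "\<delta> \<G> = directional a"
    using directional[OF \<G>] by blast
  then have "\<delta> \<G> ^^ m \<in> weyl_algebra"
    using directional_power_weyl by (simp only:)
  then have "basis_op \<A>\<^sub>0 \<G> \<in> arrangement_ops p \<A>\<^sub>0"
    using dvd_imp_preserves[OF assms] unfolding arrangement_ops_iff basis_op_def
    by (simp add: weyl_scale op_scale_apply)
  moreover have "basis_op \<A>\<^sub>0 \<G> \<in> ops_of_order m"
    unfolding ops_of_order_eq basis_op_def using \<G>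
    by (intro diffop.span_scale diffop.span_base imageI)
  ultimately show ?thesis
    by (simp add: arrangement_ops_of_order_def)
qed

text \<open>The coefficients with respect to the $\delta_G^m$ are divisible by the products $P'_G$, and the
  quotients are the coefficients with respect to the basis.\<close>

lemma arrangement_ops_in_span:
  assumes "\<A>\<^sub>0 \<subseteq> \<A>" and \<theta>: "\<theta> \<in> arrangement_ops_of_order p m \<A>\<^sub>0"
  shows "\<theta> \<in> diffop.span (basis_op \<A>\<^sub>0 ` [\<A>]\<^bsup>k\<^esup>)"
proof -
  have "\<theta> \<in> diffop.span ((\<lambda>\<G>. \<delta> \<G> ^^ m) ` [\<A>]\<^bsup>k\<^esup>)"
    using \<theta> by (simp add: arrangement_ops_of_order_def ops_of_order_eq)
  then obtain u where "\<theta> = (\<Sum>\<eta>\<in>(\<lambda>\<G>. \<delta> \<G> ^^ m) ` [\<A>]\<^bsup>k\<^esup>. u \<eta> \<cdot>\<^sub>S \<eta>)"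
    unfolding diffop.span_finite[OF finite_imageI[OF finite_nsets]] by blast
  then have \<theta>_eq: "\<theta> = (\<Sum>\<G>\<in>[\<A>]\<^bsup>k\<^esup>. u (\<delta> \<G> ^^ m) \<cdot>\<^sub>S (\<delta> \<G> ^^ m))"
    by (simp add: sum.reindex[OF inj_on_powers])
  have preserves: "(\<Prod>H\<in>\<A>\<^sub>0. p H) dvd
      (\<Sum>\<G>\<in>[\<A>]\<^bsup>k\<^esup>. u (\<delta> \<G> ^^ m) * (\<delta> \<G> ^^ m) ((\<Prod>H\<in>\<A>\<^sub>0. p H) * h))" for h
  proof -
    have "(\<Prod>H\<in>\<A>\<^sub>0. p H) dvd \<theta> ((\<Prod>H\<in>\<A>\<^sub>0. p H) * h)"
      using \<theta> by (simp add: arrangement_ops_of_order_def arrangement_ops_iff)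
    then show ?thesis
      by (simp add: \<theta>_eq sum_fun_apply op_scale_def)
  qed
  show ?thesis
    unfolding \<theta>_eq
  proof (rule diffop.span_sum)
    fix \<G> assume \<G>: "\<G> \<in> [\<A>]\<^bsup>k\<^esup>"
    then obtain g where "u (\<delta> \<G> ^^ m) = (\<Prod>H\<in>\<A>\<^sub>0 - \<G>. p H) * g"
      using preserves_imp_dvd[OF assms(1) refl preserves] by (auto simp: dvd_def)
    then have "u (\<delta> \<G> ^^ m) \<cdot>\<^sub>S (\<delta> \<G> ^^ m) = g \<cdot>\<^sub>S basis_op \<A>\<^sub>0 \<G>"
      by (simp add: basis_op_def mult.commute)
    then show "u (\<delta> \<G> ^^ m) \<cdot>\<^sub>S (\<delta> \<G> ^^ m) \<in> diffop.span (basis_op \<A>\<^sub>0 ` [\<A>]\<^bsup>k\<^esup>)"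
      using \<G> by (simp add: diffop.span_scale diffop.span_base)
  qed
qed

theorem free_with_basis_op:
  assumes "\<A>\<^sub>0 \<subseteq> \<A>"
  shows "free_with_basis (arrangement_ops_of_order p m \<A>\<^sub>0) (basis_op \<A>\<^sub>0 ` [\<A>]\<^bsup>k\<^esup>)"
  unfolding free_with_basis_def
proof (intro conjI subset_antisym)
  show B: "basis_op \<A>\<^sub>0 ` [\<A>]\<^bsup>k\<^esup> \<subseteq> arrangement_ops_of_order p m \<A>\<^sub>0"
    using basis_op_in[OF assms] by blast
  show "diffop.span (basis_op \<A>\<^sub>0 ` [\<A>]\<^bsup>k\<^esup>) \<subseteq> arrangement_ops_of_order p m \<A>\<^sub>0"
    using B subspace_arrangement_ops_of_order by (rule diffop.span_minimal)
  show "arrangement_ops_of_order p m \<A>\<^sub>0 \<subseteq> diffop.span (basis_op \<A>\<^sub>0 ` [\<A>]\<^bsup>k\<^esup>)"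
    using arrangement_ops_in_span[OF assms] by blast
qed (use assms subspace_arrangement_ops_of_order basis_op_independent in auto)

end

lemma const_derivations_eq: "const_derivations = range directional"
  by (simp add: const_derivations_def directional_def)

lemma linear_forms_eq: "linear_forms = range linear_form"
  by (simp add: linear_forms_def linear_form_def)

text \<open>If $\delta_G$, the derivative in direction $a_G$, annihilated a form $p_H$ with $H \notin G$, then $a_G$ would lie
  on the $n$ hyperplanes of $G \cup \{H\}$.  These meet only at the origin, so $\delta_G$ would be zero.\<close>

lemma dual_directional_generic:
  fixes \<A> :: "('a::field_char_0 ^ 'n::finite) set set"
  assumes n: "CARD('n) \<ge> 2" and m: "m \<ge> 1"
    and generic: "generic_arrangement \<A>" and card: "card \<A> = CARD('n) + m - 1"
    and p: "\<And>H. H \<in> \<A> \<Longrightarrow> defining_form H (p H)"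
    and \<delta>: "\<And>\<H>. \<H> \<in> [\<A>]\<^bsup>(CARD('n) - 1)\<^esup> \<Longrightarrow>
           \<delta> \<H> \<in> annihilating_derivations p \<H> \<and> \<delta> \<H> \<noteq> 0"
  shows "dual_directional \<A> (CARD('n) - 1) m p \<delta>"
proof -
  let ?I = "[\<A>]\<^bsup>(CARD('n) - 1)\<^esup>"
  have finite_A: "finite \<A>"
    using generic by (simp add: generic_arrangement_def arrangement_def)
  have "\<exists>a. \<delta> \<G> = directional a" if "\<G> \<in> ?I" for \<G>
    using \<delta>[OF that] by (auto simp: annihilating_derivations_def const_derivations_eq)
  then obtain a where a: "\<delta> \<G> = directional (a \<G>)" if "\<G> \<in> ?I" for \<G>
    by metis
  have "\<exists>b. p H = linear_form b" if "H \<in> \<A>" for H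
    using p[OF that] by (auto simp: defining_form_def linear_forms_eq)
  then obtain b where b: "p H = linear_form (b H)" if "H \<in> \<A>" for H
    by metis
  have pairing_form: "\<delta> \<G> (p H) = Const (\<Sum>i\<in>UNIV. a \<G> $ i * b H $ i)" if "\<G> \<in> ?I" "H \<in> \<A>" for \<G> H
    unfolding a[OF that(1)] b[OF that(2)] by (rule directional_linear_form)
  have mem: "a \<G> \<in> H \<longleftrightarrow> \<delta> \<G> (p H) = 0" if "\<G> \<in> ?I" "H \<in> \<A>" for \<G> H
  proof -
    have "H = {v. eval_mpoly v (p H) = 0}"
      using p[OF that(2)] by (simp add: defining_form_def)
    then have "a \<G> \<in> H \<longleftrightarrow> eval_mpoly (a \<G>) (p H) = 0"
      by blast
    then show ?thesis
      unfolding pairing_form[OF that] unfolding b[OF that(2)] eval_mpoly_linear_form Const_eq_0_iff .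
  qed
  have kill: "\<delta> \<G> (p H) = 0" if "\<G> \<in> ?I" "H \<in> \<G>" for \<G> H
    using \<delta>[OF that(1)] that(2) by (simp add: annihilating_derivations_def)
  have nonzero: "\<delta> \<G> (p H) \<noteq> 0" if "\<G> \<in> ?I" "H \<in> \<A> - \<G>" for \<G> H
  proof
    assume "\<delta> \<G> (p H) = 0"
    have \<G>: "\<G> \<subseteq> \<A>" "finite \<G>" "card \<G> = CARD('n) - 1"
      using that(1) by (auto simp: nsets_def)
    have "insert H \<G> \<in> [\<A>]\<^bsup>CARD('n)\<^esup>"
      using \<G> that(2) n by (simp add: nsets_def)
    then have "\<Inter>(insert H \<G>) = {0}"
      using generic by (simp only: generic_arrangement_def)
    moreover have "a \<G> \<in> H'" if "H' \<in> insert H \<G>" for H'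
    proof -
      have "\<delta> \<G> (p H') = 0"
        using that \<open>\<delta> \<G> (p H) = 0\<close> kill[OF \<open>\<G> \<in> ?I\<close>] by blast
      moreover have "H' \<in> \<A>"
        using that \<open>H \<in> \<A> - \<G>\<close> \<G>(1) by blast
      ultimately show ?thesis
        using mem[OF \<open>\<G> \<in> ?I\<close>] by blast
    qed
    ultimately have "a \<G> = 0"
      by blast
    then have "\<delta> \<G> = 0"
      by (simp add: a[OF that(1)] fun_eq_iff directional_apply)
    then show False
      using \<delta>[OF that(1)] by blast
  qed
  show ?thesis
  proof (intro dual_directional.intro dual_derivations.intro dual_directional_axioms.intro)
    show "card \<A> = CARD('n) - 1 + m"
      using card n by simp
    show "\<delta> \<G> (p H) dvd 1" if "\<G> \<in> ?I" "H \<in> \<A> - \<G>" for \<G> H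
    proof -
      have "H \<in> \<A>"
        using that(2) by blast
      then show ?thesis
        using nonzero[OF that] pairing_form[OF that(1)] Const_dvd_1 by (metis Const_0)
    qed
    show "\<exists>N. (\<delta> \<G> ^^ N) f = 0" if "\<G> \<in> ?I" for \<G> f
      unfolding a[OF that] by (rule directional_nilpotent)
    show "derivation (\<delta> \<G>)" if "\<G> \<in> ?I" for \<G>
      unfolding a[OF that] by (rule derivation_directional)
    show "\<delta> \<G> (\<delta> \<G>' (p H)) = 0" if "\<G> \<in> ?I" "\<G>' \<in> ?I" "H \<in> \<A>" for \<G> \<G>' H
      unfolding pairing_form[OF that(2,3)] a[OF that(1)] by (rule directional_Const)
  qed (use n m finite_A of_nat_dvd_1 kill a in auto)
qed

theorem theorem7p1:
  fixes \<A> \<A>' :: "('a::field_char_0 ^ 'n::finite) set set"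
    and p :: "('a^'n) set \<Rightarrow> ('n, 'a) mpoly"
    and \<delta> :: "('a^'n) set set \<Rightarrow> ('n, 'a) op"
    and r m :: nat
  assumes "CARD('n) \<ge> 2"
    and "generic_arrangement \<A>" and "card \<A> = r" and "r \<ge> CARD('n)"
    and "m \<ge> r - CARD('n) + 1"
    and "\<A> \<subseteq> \<A>'" and "generic_arrangement \<A>'" and "card \<A>' = CARD('n) + m - 1"
    and "\<And>H. H \<in> \<A>' \<Longrightarrow> defining_form H (p H)"
    and "\<And>\<H>. \<H> \<in> [\<A>']\<^bsup>(CARD('n) - 1)\<^esup> \<Longrightarrow>
           \<delta> \<H> \<in> annihilating_derivations p \<H> \<and> \<delta> \<H> \<noteq> 0"
  shows "free_with_basis (arrangement_ops_of_order p m \<A>)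
           ((\<lambda>\<H>. (\<Prod>H\<in>\<A> - \<H>. p H) \<cdot>\<^sub>S (\<delta> \<H> ^^ m)) ` [\<A>']\<^bsup>(CARD('n) - 1)\<^esup>)
       \<and> inj_on (\<lambda>\<H>. (\<Prod>H\<in>\<A> - \<H>. p H) \<cdot>\<^sub>S (\<delta> \<H> ^^ m)) ([\<A>']\<^bsup>(CARD('n) - 1)\<^esup>)"
proof -
  have "m \<ge> 1"
    using assms(5) by simp
  then interpret dual_directional \<A>' "CARD('n) - 1" m p \<delta>
    using assms(1,7-10) by (intro dual_directional_generic)
  show ?thesis
    using free_with_basis_op[OF assms(6)] inj_on_basis_op[OF assms(6)]
    unfolding basis_op_def[abs_def] by (rule conjI)
qed

end
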